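(* Let $\varphi$ be an Orlicz function with $\varphi\in\delta_2(0)$. Then $$J(S_\varphi)\ge\max\{(\alpha_\varphi)^{-1},\,2\beta_\varphi\},$$ where $S_\varphi$ carries the Luxemburg norm.
   Context: $\mathcal H$ is an infinite-dimensional complex separable Hilbert space and $s_1(T)\ge s_2(T)\ge\cdots$ are the singular values of a compact operator $T$ on $\mathcal H$. An Orlicz function is a convex, nondecreasing, continuous $\varphi:[0,\infty)\to[0,\infty]$ with $\varphi(0)=0$, $\varphi(\alpha)>0$ for $\alpha>0$ and $\varphi(\alpha)\to\infty$ as $\alpha\to\infty$. $\varphi\in\delta_2(0)$ means that there exist $u_0>0$ and $k>2$ with $\varphi(2u)\le k\varphi(u)$ for all $|u|\le u_0$. The indices are $$\alpha_\varphi=\liminf_{u\to0}\frac{\varphi^{-1}(u)}{\varphi^{-1}(2u)},\qquad \beta_\varphi=\limsup_{u\to0}\frac{\varphi^{-1}(u)}{\varphi^{-1}(2u)}\qquad(u\to0^+).$$ $\operatorname{tr}(\varphi(T)):=\sum_{n\ge1}\varphi(s_n(T))$ for compact $T$. $S_\varphi$ is the space of compact $T$ on $\mathcal H$ with $\operatorname{tr}(\varphi(\lambda T))<\infty$ for some $\lambda>0$; Luxemburg norm $\|T\|_{(\varphi)}=\inf\{\lambda>0:\operatorname{tr}(\varphi(T/\lambda))\le1\}$. The nonsquare constant of a Banach space $X$ is $J(X)=\sup\{\min(\|x+y\|,\|x-y\|):\|x\|=\|y\|=1\}$. *)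

theory Defs
  imports "HOL-Analysis.Analysis"
begin

text \<open>Complex Hilbert spaces. The inner product is linear in its first argument. Positivity and
  definiteness of the inner product follow from \<open>cinner_same\<close>; completeness is part of \<open>banach\<close>.\<close>

class complex_hilbert = banach +
  fixes scaleC :: "complex \<Rightarrow> 'a \<Rightarrow> 'a" (infixr "*\<^sub>C" 75)
    and cinner :: "'a \<Rightarrow> 'a \<Rightarrow> complex"
  assumes scaleC_add_right: "a *\<^sub>C (x + y) = a *\<^sub>C x + a *\<^sub>C y"
    and scaleC_add_left: "(a + b) *\<^sub>C x = a *\<^sub>C x + b *\<^sub>C x"
    and scaleC_scaleC: "a *\<^sub>C (b *\<^sub>C x) = (a * b) *\<^sub>C x"
    and scaleC_one: "1 *\<^sub>C x = x"
    and scaleR_scaleC: "r *\<^sub>R x = complex_of_real r *\<^sub>C x"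
    and cinner_commute: "cinner x y = cnj (cinner y x)"
    and cinner_add_left: "cinner (x + y) z = cinner x z + cinner y z"
    and cinner_scaleC_left: "cinner (a *\<^sub>C x) y = a * cinner x y"
    and cinner_same: "cinner x x = complex_of_real ((norm x)\<^sup>2)"

global_interpretation complex_vector: vector_space "scaleC :: complex \<Rightarrow> 'a \<Rightarrow> 'a::complex_hilbert"
  defines cspan = complex_vector.span
    and cdim = complex_vector.dim
  by unfold_locales (simp_all add: scaleC_add_right scaleC_add_left scaleC_scaleC scaleC_one)

definition infinite_dimensional :: "'h::complex_hilbert itself \<Rightarrow> bool" where
  "infinite_dimensional _ \<longleftrightarrow> \<not> (\<exists>B::'h set. finite B \<and> cspan B = UNIV)"

definition separable :: "'h::complex_hilbert itself \<Rightarrow> bool" where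
  "separable _ \<longleftrightarrow> (\<exists>D::'h set. countable D \<and> closure D = UNIV)"

text \<open>The type \<open>'h \<Rightarrow>\<^sub>L 'h\<close> consists of the bounded real-linear maps, so complex
  homogeneity has to be required in addition.\<close>

definition compact_operator :: "('h::complex_hilbert \<Rightarrow>\<^sub>L 'h) \<Rightarrow> bool" where
  "compact_operator T \<longleftrightarrow>
     (\<forall>c x. blinfun_apply T (c *\<^sub>C x) = c *\<^sub>C blinfun_apply T x) \<and>
     compact (closure (blinfun_apply T ` cball 0 1))"

definition adjoint_op :: "('h::complex_hilbert \<Rightarrow>\<^sub>L 'h) \<Rightarrow> ('h \<Rightarrow>\<^sub>L 'h)" where
  "adjoint_op T =
     (THE S. \<forall>x y. cinner (blinfun_apply T x) y = cinner x (blinfun_apply S y))"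

text \<open>The singular values are the square roots of the eigenvalues of \<open>T\<^sup>* T\<close>, in decreasing
  order and repeated according to multiplicity; if only finitely many of them are positive, the
  sequence is continued by zeros. A nonincreasing null sequence is determined by how often it takes
  each value \<open>t > 0\<close>, which is finitely often. Indices start at 0, so
  \<open>singular_values T n\<close> is \<open>s\<^sub>n\<^sub>+\<^sub>1(T)\<close>. This is meaningful for compact \<open>T\<close> only.\<close>

definition singular_values :: "('h::complex_hilbert \<Rightarrow>\<^sub>L 'h) \<Rightarrow> nat \<Rightarrow> real" where
  "singular_values T =
     (THE s. decseq s \<and> s \<longlonglongrightarrow> 0 \<and>
        (\<forall>t>0. card {n. s n = t} =
           cdim {x. blinfun_apply (adjoint_op T) (blinfun_apply T x)
                      = complex_of_real (t\<^sup>2) *\<^sub>C x}))"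

text \<open>Functions on \<open>[0,\<infinity>)\<close> are represented by functions on all reals whose
  values at negative arguments are irrelevant.\<close>

definition orlicz_function :: "(real \<Rightarrow> ennreal) \<Rightarrow> bool" where
  "orlicz_function \<phi> \<longleftrightarrow>
     (\<forall>x\<ge>0. \<forall>y\<ge>0. \<forall>t\<in>{0..1}.
        \<phi> (t * x + (1 - t) * y) \<le> ennreal t * \<phi> x + ennreal (1 - t) * \<phi> y) \<and>
     mono_on {0..} \<phi> \<and>
     continuous_on {0..} \<phi> \<and>
     \<phi> 0 = 0 \<and>
     (\<forall>x>0. \<phi> x > 0) \<and>
     (\<phi> \<longlongrightarrow> \<infinity>) at_top"

definition delta2_at_0 :: "(real \<Rightarrow> ennreal) \<Rightarrow> bool" where
  "delta2_at_0 \<phi> \<longleftrightarrow>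
     (\<exists>u0>0. \<exists>k>2. \<forall>u\<in>{0..u0}. \<phi> (2 * u) \<le> ennreal k * \<phi> u)"

text \<open>An Orlicz function takes every value \<open>u\<close> with \<open>0 \<le> u < \<infinity>\<close> at exactly one point
  of \<open>[0,\<infinity>)\<close>, so this is the usual inverse.\<close>

definition orlicz_inv :: "(real \<Rightarrow> ennreal) \<Rightarrow> real \<Rightarrow> real" where
  "orlicz_inv \<phi> u = inv_into {0..} \<phi> (ennreal u)"

definition alpha_index :: "(real \<Rightarrow> ennreal) \<Rightarrow> ereal" where
  "alpha_index \<phi> = Liminf (at_right 0) (\<lambda>u. ereal (orlicz_inv \<phi> u / orlicz_inv \<phi> (2 * u)))"

definition beta_index :: "(real \<Rightarrow> ennreal) \<Rightarrow> ereal" where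
  "beta_index \<phi> = Limsup (at_right 0) (\<lambda>u. ereal (orlicz_inv \<phi> u / orlicz_inv \<phi> (2 * u)))"

definition tr_orlicz :: "(real \<Rightarrow> ennreal) \<Rightarrow> ('h::complex_hilbert \<Rightarrow>\<^sub>L 'h) \<Rightarrow> ennreal" where
  "tr_orlicz \<phi> T = (\<Sum>n. \<phi> (singular_values T n))"

definition orlicz_schatten :: "(real \<Rightarrow> ennreal) \<Rightarrow> ('h::complex_hilbert \<Rightarrow>\<^sub>L 'h) set" where
  "orlicz_schatten \<phi> =
     {T. compact_operator T \<and> (\<exists>r>0. tr_orlicz \<phi> (r *\<^sub>R T) < \<infinity>)}"

definition luxemburg_norm :: "(real \<Rightarrow> ennreal) \<Rightarrow> ('h::complex_hilbert \<Rightarrow>\<^sub>L 'h) \<Rightarrow> real" where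
  "luxemburg_norm \<phi> T = Inf {r. r > 0 \<and> tr_orlicz \<phi> (T /\<^sub>R r) \<le> 1}"

text \<open>The normed space is given by its carrier \<open>X\<close> and its norm \<open>nrm\<close>, since the Luxemburg
  norm differs from the operator norm carried by the type. The supremum is taken in the extended
  reals, where it always exists.\<close>

definition nonsquare_const :: "'v::ab_group_add set \<Rightarrow> ('v \<Rightarrow> real) \<Rightarrow> ereal" where
  "nonsquare_const X nrm =
     Sup {ereal (min (nrm (x + y)) (nrm (x - y))) | x y.
            x \<in> X \<and> y \<in> X \<and> nrm x = 1 \<and> nrm y = 1}"

end

theory Submission
  imports Defs
begin

text \<open>Write \<open>g = \<phi>\<inverse>\<close>. If \<open>T\<close> is diagonal in an orthonormal family with \<open>m\<close> entries of modulus
  \<open>a\<close> and all others zero, then \<open>\<parallel>T\<parallel> = a / g(1/m)\<close>. Two operators with \<open>n\<close> equal entries each and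
  disjoint supports give \<open>J \<ge> g(1/n) / g(1/2n)\<close>. Two operators with \<open>2n\<close> entries of the same
  modulus, whose signs agree on one half and differ on the other, give \<open>J \<ge> 2 g(1/2n) / g(1/n)\<close>.
  Sampling the quotient \<open>g(u) / g(2u)\<close> at \<open>u = 1/2n\<close> only is harmless: \<open>g\<close> is increasing and
  \<open>g(tu) \<ge> t g(u)\<close> for \<open>t \<le> 1\<close>, so the quotient changes by a factor tending to 1 between
  consecutive sample points.\<close>

section \<open>Complex inner products\<close>

lemma cinner_add_right: "cinner x (y + z) = cinner x y + cinner x (z::'h::complex_hilbert)"
  by (metis cinner_commute cinner_add_left complex_cnj_add)

lemma cinner_scaleC_right: "cinner x (a *\<^sub>C y) = cnj a * cinner x (y::'h::complex_hilbert)"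
  by (metis cinner_commute cinner_scaleC_left complex_cnj_mult)

lemma cinner_zero_left [simp]: "cinner 0 (x::'h::complex_hilbert) = 0"
  using cinner_add_left[of 0 0 x] by simp

lemma cinner_zero_right [simp]: "cinner (x::'h::complex_hilbert) 0 = 0"
  using cinner_add_right[of x 0 0] by simp

lemma cinner_diff_left: "cinner (x - y) z = cinner x z - cinner y (z::'h::complex_hilbert)"
  using cinner_add_left[of "x - y" y z] by simp

lemma cinner_diff_right: "cinner x (y - z) = cinner x y - cinner x (z::'h::complex_hilbert)"
  using cinner_add_right[of x "y - z" z] by simp

lemma cinner_sum_left: "cinner (sum f A) (y::'h::complex_hilbert) = (\<Sum>i\<in>A. cinner (f i) y)"
  by (induction A rule: infinite_finite_induct) (simp_all add: cinner_add_left)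

lemma cinner_sum_right: "cinner (y::'h::complex_hilbert) (sum f A) = (\<Sum>i\<in>A. cinner y (f i))"
  by (induction A rule: infinite_finite_induct) (simp_all add: cinner_add_right)

lemma cinner_self_eq_0: "cinner x x = 0 \<longleftrightarrow> x = (0::'h::complex_hilbert)"
  by (simp add: cinner_same)

lemma norm_scaleC: "norm (a *\<^sub>C x) = cmod a * norm (x::'h::complex_hilbert)"
proof -
  have "complex_of_real ((norm (a *\<^sub>C x))\<^sup>2) = (a * cnj a) * complex_of_real ((norm x)\<^sup>2)"
    by (simp only: cinner_same[symmetric] cinner_scaleC_left cinner_scaleC_right mult_ac)
  also have "\<dots> = complex_of_real ((cmod a * norm x)\<^sup>2)"
    by (simp only: complex_norm_square[symmetric] of_real_mult[symmetric] power_mult_distrib)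
  finally have "(norm (a *\<^sub>C x))\<^sup>2 = (cmod a * norm x)\<^sup>2"
    by (simp only: of_real_eq_iff)
  then show ?thesis
    by (rule power2_eq_imp_eq) simp_all
qed

text \<open>Bessel's inequality for one unit vector: removing from \<open>x\<close> its component
  along \<open>e\<close> leaves a vector whose squared norm is that of \<open>x\<close> minus the
  squared modulus of the coefficient, and this is nonnegative.\<close>

lemma cmod_cinner_le_norm:
  fixes x e :: "'h::complex_hilbert"
  assumes "cinner e e = 1"
  shows "cmod (cinner x e) \<le> norm x"
proof -
  define z where "z = cinner x e"
  have ex: "cinner e x = cnj z"
    unfolding z_def by (rule cinner_commute)
  have "complex_of_real ((norm (x - z *\<^sub>C e))\<^sup>2) = complex_of_real ((norm x)\<^sup>2) - z * cnj z"
    using assms ex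
    by (simp add: cinner_same[symmetric] cinner_diff_left cinner_diff_right
        cinner_scaleC_left cinner_scaleC_right z_def[symmetric] algebra_simps
        del: of_real_power)
  also have "\<dots> = complex_of_real ((norm x)\<^sup>2 - (cmod z)\<^sup>2)"
    by (simp only: complex_norm_square[symmetric] of_real_diff)
  finally have "(norm (x - z *\<^sub>C e))\<^sup>2 = (norm x)\<^sup>2 - (cmod z)\<^sup>2"
    by (simp only: of_real_eq_iff)
  then have "(cmod z)\<^sup>2 \<le> (norm x)\<^sup>2"
    by (metis diff_ge_0_iff_ge zero_le_power2)
  then show ?thesis
    unfolding z_def by (rule power2_le_imp_le) simp
qed

text \<open>Supplies the continuity that makes a closed disc in the complex line through
  \<open>x\<close> compact, as the image of a disc in the plane.\<close>

lemma bounded_linear_scaleC_left: "bounded_linear (\<lambda>z. z *\<^sub>C (x::'h::complex_hilbert))"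
  by (rule bounded_linear_intro[where K = "norm x"])
    (simp_all add: scaleC_add_left norm_scaleC scaleR_scaleC scaleC_scaleC scaleR_conv_of_real)

section \<open>Orthonormal families\<close>

text \<open>Only the first \<open>N\<close> members are constrained. Finite families suffice because
  every test operator has finite rank.\<close>

definition orthonormal :: "nat \<Rightarrow> (nat \<Rightarrow> 'h::complex_hilbert) \<Rightarrow> bool" where
  "orthonormal N e \<longleftrightarrow> (\<forall>i<N. \<forall>j<N. cinner (e i) (e j) = (if i = j then 1 else 0))"

lemma orthonormalD:
  "orthonormal N e \<Longrightarrow> i < N \<Longrightarrow> j < N \<Longrightarrow> cinner (e i) (e j) = (if i = j then 1 else 0)"
  by (simp add: orthonormal_def)

text \<open>The index set \<open>A\<close> may be a proper subset of the family, so that the same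
  coordinate formula also yields the independence of subfamilies.\<close>

lemma cinner_sum_orthonormal:
  assumes "orthonormal N e" "A \<subseteq> {..<N}" "j < N"
  shows "cinner (\<Sum>i\<in>A. f i *\<^sub>C e i) (e j) = (if j \<in> A then f j else 0)"
proof -
  have fin: "finite A"
    using assms(2) finite_subset by blast
  have "cinner (\<Sum>i\<in>A. f i *\<^sub>C e i) (e j) = (\<Sum>i\<in>A. if i = j then f i else 0)"
    unfolding cinner_sum_left cinner_scaleC_left
    using assms by (intro sum.cong) (auto simp: orthonormalD[OF assms(1)] subset_eq)
  then show ?thesis
    using fin by simp
qed

lemma orthonormal_inj_on: "orthonormal N e \<Longrightarrow> inj_on e {..<N}"
  by (rule inj_onI) (metis lessThan_iff orthonormalD zero_neq_one)

lemma orthonormal_independent: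
  assumes "orthonormal N e" "A \<subseteq> {..<N}"
  shows "complex_vector.independent (e ` A)"
proof -
  have fin: "finite A"
    using assms(2) finite_subset by blast
  have inj: "inj_on e A"
    using orthonormal_inj_on[OF assms(1)] assms(2) inj_on_subset by blast
  have "u (e j) = 0" if "(\<Sum>v\<in>e ` A. u v *\<^sub>C v) = 0" "j \<in> A" for u j
  proof -
    have "(\<Sum>i\<in>A. u (e i) *\<^sub>C e i) = 0"
      using that(1) by (simp add: sum.reindex[OF inj])
    then show ?thesis
      using cinner_sum_orthonormal[OF assms, of j "\<lambda>i. u (e i)"] that(2) assms(2) by auto
  qed
  then show ?thesis
    using fin by (intro complex_vector.independent_if_scalars_zero) auto
qed

text \<open>One Gram-Schmidt step per induction step: by infinite dimension some vector lies outside
  the span of the finitely many vectors found so far. Its component orthogonal to them is therefore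
  nonzero and can be normalised.\<close>

lemma exists_orthonormal:
  assumes "infinite_dimensional TYPE('h::complex_hilbert)"
  shows "\<exists>e :: nat \<Rightarrow> 'h. orthonormal N e"
proof (induction N)
  case 0
  show ?case
    by (simp add: orthonormal_def)
next
  case (Suc N)
  then obtain e :: "nat \<Rightarrow> 'h" where e: "orthonormal N e"
    by blast
  have "cspan (e ` {..<N}) \<noteq> UNIV"
    using assms unfolding infinite_dimensional_def by blast
  then obtain v where v: "v \<notin> cspan (e ` {..<N})"
    by blast
  define w where "w = v - (\<Sum>i<N. cinner v (e i) *\<^sub>C e i)"
  have "(\<Sum>i<N. cinner v (e i) *\<^sub>C e i) \<in> cspan (e ` {..<N})"
    by (rule complex_vector.span_sum, rule complex_vector.span_scale,
        rule complex_vector.span_base) auto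
  then have "w \<noteq> 0"
    using v unfolding w_def by auto
  have w_orth: "cinner w (e j) = 0" if "j < N" for j
    using cinner_sum_orthonormal[OF e subset_refl, of j] that
    by (simp add: w_def cinner_diff_left)
  define u where "u = complex_of_real (inverse (norm w)) *\<^sub>C w"
  have "cinner u u = 1"
    using \<open>w \<noteq> 0\<close>
    by (simp add: u_def cinner_same norm_scaleC norm_inverse)
  moreover have "cinner u (e j) = 0" if "j < N" for j
    using w_orth[OF that] by (simp add: u_def cinner_scaleC_left)
  moreover have "cinner (e j) u = 0" if "j < N" for j
    using calculation(2)[OF that] by (metis cinner_commute complex_cnj_zero)
  ultimately have "orthonormal (Suc N) (e(N := u))"
    using e by (auto simp: orthonormal_def less_Suc_eq)
  then show ?case
    by blast
qed

section \<open>Finite-rank diagonal operators\<close>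

text \<open>Real coefficients make the operator selfadjoint, so its singular values can be read off
  from its square. That \<open>Blinfun\<close> really yields this map is derived from orthonormality
  in \<open>diag_op_apply\<close>.\<close>

definition diag_op :: "(nat \<Rightarrow> 'h::complex_hilbert) \<Rightarrow> nat \<Rightarrow> (nat \<Rightarrow> real) \<Rightarrow> ('h \<Rightarrow>\<^sub>L 'h)" where
  "diag_op e N c = Blinfun (\<lambda>x. \<Sum>i<N. (complex_of_real (c i) * cinner x (e i)) *\<^sub>C e i)"

lemma diag_op_apply:
  assumes "orthonormal N e"
  shows "blinfun_apply (diag_op e N c) x
           = (\<Sum>i<N. (complex_of_real (c i) * cinner x (e i)) *\<^sub>C e i)"
proof -
  have "bounded_linear (\<lambda>x. (complex_of_real (c i) * cinner x (e i)) *\<^sub>C e i)" if "i < N" for i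
  proof (rule bounded_linear_intro[where K = "\<bar>c i\<bar>"])
    have e: "cinner (e i) (e i) = 1"
      using orthonormalD[OF assms that that] by simp
    then have "(norm (e i))\<^sup>2 = 1"
      by (metis cinner_same of_real_eq_1_iff)
    then have ne: "norm (e i) = 1"
      using power2_eq_1_iff norm_ge_zero by (smt (verit))
    show "norm ((complex_of_real (c i) * cinner x (e i)) *\<^sub>C e i) \<le> norm x * \<bar>c i\<bar>" for x
      using mult_left_mono[OF cmod_cinner_le_norm[OF e, of x], of "\<bar>c i\<bar>"]
      by (simp add: norm_scaleC norm_mult ne mult.commute)
  qed (simp_all add: cinner_add_left scaleC_add_left scaleR_scaleC cinner_scaleC_left
      scaleC_scaleC algebra_simps)
  then have "bounded_linear (\<lambda>x. \<Sum>i<N. (complex_of_real (c i) * cinner x (e i)) *\<^sub>C e i)"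
    by (intro bounded_linear_sum) auto
  then show ?thesis
    by (simp add: diag_op_def bounded_linear_Blinfun_apply)
qed

lemma diag_op_scaleR:
  assumes "orthonormal N e"
  shows "r *\<^sub>R diag_op e N c = diag_op e N (\<lambda>i. r * c i)"
  by (rule blinfun_eqI)
    (simp add: diag_op_apply[OF assms] blinfun.scaleR_left scaleR_scaleC
      complex_vector.scale_sum_right scaleC_scaleC mult.assoc)

lemma diag_op_add:
  assumes "orthonormal N e"
  shows "diag_op e N c + diag_op e N d = diag_op e N (\<lambda>i. c i + d i)"
  by (rule blinfun_eqI)
    (simp add: diag_op_apply[OF assms] blinfun.add_left sum.distrib[symmetric]
      scaleC_add_left[symmetric] distrib_right)

lemma diag_op_diff:
  assumes "orthonormal N e"
  shows "diag_op e N c - diag_op e N d = diag_op e N (\<lambda>i. c i - d i)"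
proof -
  have "diag_op e N c - diag_op e N d = diag_op e N c + (-1) *\<^sub>R diag_op e N d"
    by simp
  then show ?thesis
    by (simp only: diag_op_scaleR[OF assms] diag_op_add[OF assms]) simp
qed

lemma compact_diag_op:
  assumes "orthonormal N e"
  shows "compact_operator (diag_op e N c)"
  unfolding compact_operator_def
proof (intro conjI allI)
  show "blinfun_apply (diag_op e N c) (a *\<^sub>C x) = a *\<^sub>C blinfun_apply (diag_op e N c) x" for a x
    by (simp add: diag_op_apply[OF assms] cinner_scaleC_left complex_vector.scale_sum_right
        scaleC_scaleC mult.left_commute)
  \<comment> \<open>\<open>K M\<close> is the sum of discs in the complex lines through the first
    \<open>M\<close> vectors, hence compact by induction as an iterated Minkowski sum of compact
    sets. The image of the unit ball lies in \<open>K N\<close> because each coordinate of a vector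
    in the ball has modulus at most 1.\<close>
  define K where "K M = {\<Sum>i<M. z i *\<^sub>C e i | z. \<forall>i<M. z i \<in> cball 0 \<bar>c i\<bar>}" for M
  have "compact (K M)" for M
  proof (induction M)
    case 0
    have "K 0 = {0}"
      by (auto simp: K_def)
    then show ?case
      by simp
  next
    case (Suc M)
    have "K (Suc M) = {x + y | x y. x \<in> K M \<and> y \<in> (\<lambda>z. z *\<^sub>C e M) ` cball 0 \<bar>c M\<bar>}"
      (is "_ = ?R")
    proof (intro equalityI subsetI)
      fix x assume "x \<in> K (Suc M)"
      then show "x \<in> ?R"
        unfolding K_def by fastforce
    next
      fix x assume "x \<in> ?R"
      then obtain z w where zw: "x = (\<Sum>i<M. z i *\<^sub>C e i) + w *\<^sub>C e M"
        "\<forall>i<M. z i \<in> cball 0 \<bar>c i\<bar>" "w \<in> cball 0 \<bar>c M\<bar>"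
        unfolding K_def by auto
      then show "x \<in> K (Suc M)"
        unfolding K_def by (intro CollectI exI[of _ "z(M := w)"]) (auto simp: less_Suc_eq)
    qed
    moreover have "compact ((\<lambda>z. z *\<^sub>C e M) ` cball 0 \<bar>c M\<bar>)"
      by (intro compact_continuous_image compact_cball linear_continuous_on
          bounded_linear_scaleC_left)
    ultimately show ?case
      using compact_sums[OF Suc] by simp
  qed
  moreover have "blinfun_apply (diag_op e N c) ` cball 0 1 \<subseteq> K N"
  proof (rule image_subsetI)
    fix x :: 'a assume x: "x \<in> cball 0 1"
    have "cmod (cinner x (e i)) \<le> 1" if "i < N" for i
      using cmod_cinner_le_norm[of "e i" x] orthonormalD[OF assms that that] x by simp
    then have "\<forall>i<N. complex_of_real (c i) * cinner x (e i) \<in> cball 0 \<bar>c i\<bar>"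
      by (simp add: norm_mult mult_left_le)
    then show "blinfun_apply (diag_op e N c) x \<in> K N"
      unfolding diag_op_apply[OF assms] K_def
      by (intro CollectI exI[of _ "\<lambda>i. complex_of_real (c i) * cinner x (e i)"] conjI refl)
  qed
  ultimately show "compact (closure (blinfun_apply (diag_op e N c) ` cball 0 1))"
    by (metis closed_closure closure_minimal compact_Int_closed compact_imp_closed inf.absorb_iff2)
qed

text \<open>Selfadjointness holds because the coefficients are real. The \<open>THE\<close> also
  asks for uniqueness: the values of two candidates at \<open>y\<close> differ by a vector
  \<open>d\<close> orthogonal to everything, and testing against \<open>d\<close> itself gives
  \<open>d = 0\<close>.\<close>

lemma adjoint_diag_op:
  assumes "orthonormal N e"
  shows "adjoint_op (diag_op e N c) = diag_op e N c"
  unfolding adjoint_op_def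
proof (rule the_equality)
  show *: "\<forall>x y. cinner (blinfun_apply (diag_op e N c) x) y
                 = cinner x (blinfun_apply (diag_op e N c) y)"
  proof (intro allI)
    fix x y :: 'a
    show "cinner (blinfun_apply (diag_op e N c) x) y = cinner x (blinfun_apply (diag_op e N c) y)"
      unfolding diag_op_apply[OF assms] cinner_sum_left cinner_sum_right cinner_scaleC_left
        cinner_scaleC_right
    proof (rule sum.cong[OF refl])
      fix i
      show "complex_of_real (c i) * cinner x (e i) * cinner (e i) y
              = cnj (complex_of_real (c i) * cinner y (e i)) * cinner x (e i)"
        using cinner_commute[of "e i" y] by simp
    qed
  qed
  fix S assume S: "\<forall>x y. cinner (blinfun_apply (diag_op e N c) x) y = cinner x (blinfun_apply S y)"
  show "S = diag_op e N c"
  proof (rule blinfun_eqI)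
    fix y
    define d where "d = blinfun_apply S y - blinfun_apply (diag_op e N c) y"
    have "cinner d d = 0"
      using S * by (subst (2) d_def) (simp add: cinner_diff_right)
    then show "blinfun_apply S y = blinfun_apply (diag_op e N c) y"
      by (simp add: cinner_self_eq_0 d_def)
  qed
qed

section \<open>Eigenspaces and singular values of diagonal operators\<close>

lemma eigenspace_diag_op:
  assumes "orthonormal N e" "t > 0"
  shows "{x. blinfun_apply (diag_op e N c) (blinfun_apply (diag_op e N c) x)
               = complex_of_real (t\<^sup>2) *\<^sub>C x} = cspan (e ` {i. i < N \<and> \<bar>c i\<bar> = t})"
    (is "?E = cspan (e ` ?A)")
proof -
  \<comment> \<open>The square multiplies the coordinate along \<open>e i\<close> by the square of
    \<open>c i\<close>. Comparing coordinates in the eigenvalue equation then kills every coordinate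
    whose coefficient does not have modulus \<open>t\<close>.\<close>
  have TT: "blinfun_apply (diag_op e N c) (blinfun_apply (diag_op e N c) x)
      = (\<Sum>i<N. (complex_of_real ((c i)\<^sup>2) * cinner x (e i)) *\<^sub>C e i)" for x
    unfolding diag_op_apply[OF assms(1), of c "blinfun_apply (diag_op e N c) x"]
    by (rule sum.cong[OF refl])
      (simp add: diag_op_apply[OF assms(1), of c x] cinner_sum_orthonormal[OF assms(1)]
        power2_eq_square)
  have "?E \<subseteq> cspan (e ` ?A)"
  proof
    fix x assume "x \<in> ?E"
    then have x: "(\<Sum>i<N. (complex_of_real ((c i)\<^sup>2) * cinner x (e i)) *\<^sub>C e i)
                   = complex_of_real (t\<^sup>2) *\<^sub>C x"
      by (simp add: TT)
    have zero: "cinner x (e j) = 0" if "j < N" "\<bar>c j\<bar> \<noteq> t" for j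
    proof -
      have "complex_of_real ((c j)\<^sup>2) * cinner x (e j) = complex_of_real (t\<^sup>2) * cinner x (e j)"
        using arg_cong[OF x, of "\<lambda>v. cinner v (e j)"] that(1)
        by (simp add: cinner_sum_orthonormal[OF assms(1)] cinner_scaleC_left)
      moreover have "(c j)\<^sup>2 \<noteq> t\<^sup>2"
        using that(2) assms(2) by (auto simp: power2_eq_iff)
      ultimately show ?thesis
        by (metis mult_cancel_right of_real_eq_iff)
    qed
    have "(\<Sum>i<N. (complex_of_real ((c i)\<^sup>2) * cinner x (e i)) *\<^sub>C e i) \<in> cspan (e ` ?A)"
    proof (intro complex_vector.span_sum)
      fix i assume i: "i \<in> {..<N}"
      show "(complex_of_real ((c i)\<^sup>2) * cinner x (e i)) *\<^sub>C e i \<in> cspan (e ` ?A)"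
      proof (cases "\<bar>c i\<bar> = t")
        case True
        with i have "e i \<in> cspan (e ` ?A)"
          by (intro complex_vector.span_base) blast
        then show ?thesis
          by (rule complex_vector.span_scale)
      next
        case False
        with i zero show ?thesis
          by (simp add: complex_vector.span_zero)
      qed
    qed
    \<comment> \<open>A priori \<open>x\<close> might have a component outside the span of the
      family. Since \<open>t\<close> is positive, dividing the eigenvalue equation by its square
      expresses \<open>x\<close> through the \<open>e i\<close>.\<close>
    then have "complex_of_real (inverse (t\<^sup>2)) *\<^sub>C (complex_of_real (t\<^sup>2) *\<^sub>C x) \<in> cspan (e ` ?A)"
      unfolding x by (rule complex_vector.span_scale)
    moreover have "complex_of_real (inverse (t\<^sup>2)) * complex_of_real (t\<^sup>2) = 1"
      using assms(2) by (simp flip: of_real_mult)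
    ultimately show "x \<in> cspan (e ` ?A)"
      by (simp only: scaleC_scaleC scaleC_one)
  qed
  moreover have "cspan (e ` ?A) \<subseteq> ?E"
  proof (rule complex_vector.span_minimal)
    show "e ` ?A \<subseteq> ?E"
    proof (rule image_subsetI)
      fix j assume "j \<in> ?A"
      then have j: "j < N" "(complex_of_real (c j))\<^sup>2 = (complex_of_real t)\<^sup>2"
        by (auto simp flip: of_real_power)
      have "(\<Sum>i<N. (complex_of_real ((c i)\<^sup>2) * cinner (e j) (e i)) *\<^sub>C e i)
          = (\<Sum>i<N. if i = j then complex_of_real (t\<^sup>2) *\<^sub>C e i else 0)"
        using j by (intro sum.cong) (auto simp: orthonormalD[OF assms(1)])
      then show "e j \<in> ?E"
        using j by (simp add: TT)
    qed
    show "complex_vector.subspace ?E"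
    proof -
      have "blinfun_apply (diag_op e N c) (z *\<^sub>C x) = z *\<^sub>C blinfun_apply (diag_op e N c) x" for z x
        using compact_diag_op[OF assms(1), of c] by (simp add: compact_operator_def)
      then show ?thesis
        by (simp add: complex_vector.subspace_def blinfun.add_right blinfun.zero_right
            scaleC_add_right complex_vector.scale_left_commute)
    qed
  qed
  ultimately show ?thesis
    by blast
qed

lemma dim_eigenspace_diag_op:
  assumes "orthonormal N e" "t > 0"
  shows "cdim {x. blinfun_apply (diag_op e N c) (blinfun_apply (diag_op e N c) x)
               = complex_of_real (t\<^sup>2) *\<^sub>C x} = card {i. i < N \<and> \<bar>c i\<bar> = t}"
proof -
  have sub: "{i. i < N \<and> \<bar>c i\<bar> = t} \<subseteq> {..<N}"
    by auto
  show ?thesis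
    unfolding eigenspace_diag_op[OF assms]
    using complex_vector.dim_span_eq_card_independent[OF orthonormal_independent[OF assms(1) sub]]
      card_image[OF inj_on_subset[OF orthonormal_inj_on[OF assms(1)] sub]]
    by simp
qed

text \<open>The uniqueness half of the description of \<open>singular_values\<close>: the
  multiplicities leave only the values 0 and \<open>a\<close>, and by monotonicity the places where
  \<open>a\<close> is taken form an initial segment of length \<open>m\<close>.\<close>

lemma two_valued_decseq_eq:
  fixes s :: "nat \<Rightarrow> real"
  assumes "decseq s" "s \<longlonglongrightarrow> 0" "a > 0"
    and card: "\<And>t. t > 0 \<Longrightarrow> card {n. s n = t} = (if t = a then m else 0)"
  shows "s = (\<lambda>n. if n < m then a else 0)"
proof -
  \<comment> \<open>\<open>card\<close> is 0 for infinite sets too. Only with finite level sets,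
    which come from convergence to 0, does a count of 0 mean that the value is not taken.\<close>
  have fin: "finite {n. s n = t}" if "t > 0" for t
  proof -
    have "eventually (\<lambda>n. s n < t) sequentially"
      using assms(2) that by (rule order_tendstoD)
    then obtain k where "\<forall>n\<ge>k. s n < t"
      by (auto simp: eventually_sequentially)
    then have "{n. s n = t} \<subseteq> {..<k}"
      by (force simp: not_le)
    then show ?thesis
      by (rule finite_subset) simp
  qed
  have nonneg: "s n \<ge> 0" for n
    using decseq_ge[OF assms(1,2)] .
  have vals: "s n = 0 \<or> s n = a" for n
  proof (rule ccontr)
    assume "\<not> (s n = 0 \<or> s n = a)"
    then have "s n > 0" "s n \<noteq> a"
      using nonneg[of n] by auto
    then have "{k. s k = s n} = {}"
      using card[of "s n"] fin[of "s n"] by simp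
    then show False
      by blast
  qed
  define A where "A = {n. s n = a}"
  have A: "finite A" "card A = m"
    using fin[OF assms(3)] card[OF assms(3)] by (simp_all add: A_def)
  have down: "i \<in> A" if "n \<in> A" "i \<le> n" for i n
  proof -
    have "s i \<noteq> 0"
      using decseqD[OF assms(1) that(2)] that(1) assms(3) by (simp add: A_def)
    then show ?thesis
      using vals[of i] by (simp add: A_def)
  qed
  have "n \<in> A \<longleftrightarrow> n < m" for n
  proof
    assume "n \<in> A"
    then have "{..n} \<subseteq> A"
      using down by blast
    then have "card {..n} \<le> m"
      using card_mono[OF A(1)] A(2) by blast
    then show "n < m"
      by simp
  next
    assume "n < m"
    show "n \<in> A"
    proof (rule ccontr)
      assume "n \<notin> A"
      have "A \<subseteq> {..<n}"
      proof
        fix i assume "i \<in> A"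
        then show "i \<in> {..<n}"
          using down[of i n] \<open>n \<notin> A\<close> by (cases "n \<le> i") auto
      qed
      then have "m \<le> n"
        using card_mono[of "{..<n}" A] A(2) by simp
      then show False
        using \<open>n < m\<close> by simp
    qed
  qed
  then have "s n = (if n < m then a else 0)" for n
    using vals[of n] by (cases "n < m") (auto simp: A_def)
  then show ?thesis
    by (rule ext)
qed

text \<open>The signs of the coefficients disappear in the square, so its only positive eigenvalue
  can be the square of \<open>a\<close>, with multiplicity \<open>m\<close>. This fixes the sequence
  up to order, and decrease fixes the order.\<close>

lemma singular_values_diag_op:
  assumes "orthonormal N e" "a > 0"
    and c: "\<And>i. i < N \<Longrightarrow> \<bar>c i\<bar> = 0 \<or> \<bar>c i\<bar> = a"
    and m: "card {i. i < N \<and> c i \<noteq> 0} = m"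
  shows "singular_values (diag_op e N c) = (\<lambda>n. if n < m then a else 0)"
proof -
  have dim: "cdim {x. blinfun_apply (adjoint_op (diag_op e N c)) (blinfun_apply (diag_op e N c) x)
      = complex_of_real (t\<^sup>2) *\<^sub>C x} = (if t = a then m else 0)" if "t > 0" for t
  proof -
    have "{i. i < N \<and> \<bar>c i\<bar> = t} = (if t = a then {i. i < N \<and> c i \<noteq> 0} else {})"
    proof (cases "t = a")
      case True
      then show ?thesis
        using c assms(2) by fastforce
    next
      case False
      then show ?thesis
        using c that by fastforce
    qed
    then show ?thesis
      by (simp add: adjoint_diag_op[OF assms(1)] dim_eigenspace_diag_op[OF assms(1) that] m
          del: of_real_power)
  qed
  show ?thesis
    unfolding singular_values_def
  proof (rule the_equality)
    let ?s = "\<lambda>n. if n < m then a else 0"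
    have "decseq ?s"
      using assms(2) by (auto simp: decseq_def)
    moreover have "?s \<longlonglongrightarrow> 0"
      by (rule tendsto_eventually) (auto simp: eventually_sequentially intro!: exI[of _ m])
    moreover have "card {n. ?s n = t} = (if t = a then m else 0)" if "t > 0" for t
    proof -
      have "{n. ?s n = t} = (if t = a then {..<m} else {})"
        using that assms(2) by auto
      then show ?thesis
        by simp
    qed
    ultimately show "decseq ?s \<and> ?s \<longlonglongrightarrow> 0 \<and> (\<forall>t>0. card {n. ?s n = t} =
        cdim {x. blinfun_apply (adjoint_op (diag_op e N c)) (blinfun_apply (diag_op e N c) x)
          = complex_of_real (t\<^sup>2) *\<^sub>C x})"
      using dim by simp
  qed (use dim two_valued_decseq_eq[OF _ _ assms(2)] in auto)
qed

section \<open>Orlicz functions and the Luxemburg norm\<close>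

text \<open>The intermediate value theorem applies between 0 and a point where \<phi> exceeds
  \<open>u\<close>, which exists because \<phi> tends to infinity. Thus \<open>u\<close> is attained
  even if \<phi> takes the value infinity further out.\<close>

lemma orlicz_inv:
  assumes "orlicz_function \<phi>" "u > 0"
  shows orlicz_inv_apply: "\<phi> (orlicz_inv \<phi> u) = ennreal u"
    and orlicz_inv_pos: "orlicz_inv \<phi> u > 0"
proof -
  have cont: "continuous_on {0..} \<phi>" and zero: "\<phi> 0 = 0" and lim: "(\<phi> \<longlongrightarrow> \<infinity>) at_top"
    using assms(1) by (auto simp: orlicz_function_def)
  have "eventually (\<lambda>x. \<phi> x > ennreal u \<and> x \<ge> 0) at_top"
    using order_tendstoD(1)[OF lim, of "ennreal u"]
    by (intro eventually_conj eventually_ge_at_top) (simp add: ennreal_less_top)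
  then obtain x where x: "\<phi> x > ennreal u" "x \<ge> 0"
    by (auto simp: eventually_at_top_linorder)
  have "\<exists>y\<ge>0. y \<le> x \<and> \<phi> y = ennreal u"
    using x zero by (intro IVT' continuous_on_subset[OF cont]) auto
  then have im: "ennreal u \<in> \<phi> ` {0..}"
    by (auto intro: image_eqI[OF sym])
  then show eq: "\<phi> (orlicz_inv \<phi> u) = ennreal u"
    unfolding orlicz_inv_def by (rule f_inv_into_f)
  have "orlicz_inv \<phi> u \<ge> 0"
    using inv_into_into[OF im] by (simp add: orlicz_inv_def)
  moreover have "orlicz_inv \<phi> u \<noteq> 0"
    using eq zero assms(2) by auto
  ultimately show "orlicz_inv \<phi> u > 0"
    by simp
qed

text \<open>Convexity on the segment from 0, where \<phi> vanishes; this is the form in which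
  convexity enters the proof.\<close>

lemma orlicz_star_shaped:
  assumes "orlicz_function \<phi>" "x \<ge> 0" "t \<in> {0..1}"
  shows "\<phi> (t * x) \<le> ennreal t * \<phi> x"
proof -
  have "\<phi> (t * x + (1 - t) * 0) \<le> ennreal t * \<phi> x + ennreal (1 - t) * \<phi> 0" "\<phi> 0 = 0"
    using assms unfolding orlicz_function_def by (blast, blast)
  then show ?thesis
    by simp
qed

text \<open>Monotonicity gives one direction. For the other, a point \<open>x\<close> beyond the
  inverse value \<open>b\<close> with \<phi>(x) at most \<open>u\<close> would give, by
  star-shapedness, u = \<phi>(b) \<le> (b/x) u < u.\<close>

lemma orlicz_le_iff:
  assumes "orlicz_function \<phi>" "u > 0" "x \<ge> 0"
  shows "\<phi> x \<le> ennreal u \<longleftrightarrow> x \<le> orlicz_inv \<phi> u"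
proof
  let ?b = "orlicz_inv \<phi> u"
  note b = orlicz_inv[OF assms(1,2)]
  have mono: "mono_on {0..} \<phi>"
    using assms(1) by (simp add: orlicz_function_def)
  show "\<phi> x \<le> ennreal u" if "x \<le> ?b"
    using mono_onD[OF mono, of x ?b] that assms(3) b by simp
  show "x \<le> ?b" if le: "\<phi> x \<le> ennreal u"
  proof (rule ccontr)
    assume less: "\<not> x \<le> ?b"
    then have x: "x > 0"
      using b(2) by simp
    have "ennreal u = \<phi> (?b / x * x)"
      using b x by simp
    also have "\<dots> \<le> ennreal (?b / x) * \<phi> x"
      using less b(2) x by (intro orlicz_star_shaped assms) auto
    also have "\<dots> \<le> ennreal (?b / x) * ennreal u"
      by (rule mult_left_mono[OF le]) simp
    also have "\<dots> = ennreal (?b / x * u)"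
      using assms(2) by (intro ennreal_mult''[symmetric]) simp
    finally have "u \<le> ?b / x * u"
      using b(2) x assms(2) by (simp add: ennreal_le_iff)
    then show False
      using less b(2) x assms(2) by (simp add: field_simps)
  qed
qed

lemma orlicz_inv_mono:
  assumes "orlicz_function \<phi>" "0 < u" "u \<le> v"
  shows "orlicz_inv \<phi> u \<le> orlicz_inv \<phi> v"
proof -
  have "\<phi> (orlicz_inv \<phi> u) \<le> ennreal v"
    using orlicz_inv_apply[OF assms(1,2)] assms(3) by (simp add: ennreal_leI)
  moreover have "orlicz_inv \<phi> u \<ge> 0" "v > 0"
    using orlicz_inv_pos[OF assms(1,2)] assms(2,3) by auto
  ultimately show ?thesis
    using orlicz_le_iff[OF assms(1)] by blast
qed

text \<open>Star-shapedness of \<phi> carried over to the inverse: at \<open>t\<close> times the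
  inverse value of \<open>u\<close>, \<phi> is at most \<open>t * u\<close>.\<close>

lemma orlicz_inv_scale_ge:
  assumes "orlicz_function \<phi>" "u > 0" "0 < t" "t \<le> 1"
  shows "t * orlicz_inv \<phi> u \<le> orlicz_inv \<phi> (t * u)"
proof -
  have "\<phi> (t * orlicz_inv \<phi> u) \<le> ennreal t * ennreal u"
    using orlicz_star_shaped[OF assms(1), of "orlicz_inv \<phi> u" t] orlicz_inv[OF assms(1,2)] assms
    by simp
  then show ?thesis
    using orlicz_le_iff[OF assms(1), of "t * u" "t * orlicz_inv \<phi> u"]
      orlicz_inv_pos[OF assms(1,2)] assms by (simp add: ennreal_mult'')
qed

lemma tr_orlicz_diag_op:
  assumes "orthonormal N e" "orlicz_function \<phi>" "a > 0"
    and "\<And>i. i < N \<Longrightarrow> \<bar>c i\<bar> = 0 \<or> \<bar>c i\<bar> = a"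
    and "card {i. i < N \<and> c i \<noteq> 0} = m"
  shows "tr_orlicz \<phi> (diag_op e N c) = of_nat m * \<phi> a"
proof -
  have "\<phi> 0 = 0"
    using assms(2) by (simp add: orlicz_function_def)
  then have "(\<Sum>n. \<phi> (if n < m then a else 0)) = (\<Sum>n<m. \<phi> (if n < m then a else 0))"
    by (intro suminf_finite) auto
  then show ?thesis
    by (simp add: tr_orlicz_def singular_values_diag_op[OF assms(1,3-5)])
qed

text \<open>Scaling by 1/r turns the trace into \<open>m\<close> times \<phi>(a/r). This is at most
  1 exactly if a/r is at most the inverse value of 1/m, so the admissible \<open>r\<close> form a
  closed half-line whose left end is the norm.\<close>

lemma luxemburg_norm_diag_op:
  assumes e: "orthonormal N e" and \<phi>: "orlicz_function \<phi>" and a: "a > 0"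
    and c: "\<And>i. i < N \<Longrightarrow> \<bar>c i\<bar> = 0 \<or> \<bar>c i\<bar> = a"
    and m: "card {i. i < N \<and> c i \<noteq> 0} = m" "m > 0"
  shows "luxemburg_norm \<phi> (diag_op e N c) = a / orlicz_inv \<phi> (1 / real m)"
proof -
  let ?b = "orlicz_inv \<phi> (1 / real m)"
  have b: "?b > 0"
    using m(2) by (intro orlicz_inv_pos[OF \<phi>]) simp
  have "tr_orlicz \<phi> (diag_op e N c /\<^sub>R r) \<le> 1 \<longleftrightarrow> a / ?b \<le> r" if r: "r > 0" for r
  proof -
    have "tr_orlicz \<phi> (diag_op e N c /\<^sub>R r) = of_nat m * \<phi> (inverse r * a)"
      unfolding diag_op_scaleR[OF e]
      using r a c m(1) by (intro tr_orlicz_diag_op[OF e \<phi>]) (auto simp: abs_mult)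
    also have "\<dots> \<le> 1 \<longleftrightarrow> \<phi> (inverse r * a) \<le> ennreal (1 / real m)"
    proof -
      have "of_nat m * ennreal (1 / real m) = ennreal (real m * (1 / real m))"
        by (subst ennreal_mult') (simp_all add: ennreal_of_nat_eq_real_of_nat)
      then have one: "of_nat m * ennreal (1 / real m) = 1"
        using m(2) by simp
      have "of_nat m * \<phi> (inverse r * a) \<le> of_nat m * ennreal (1 / real m)
          \<longleftrightarrow> \<phi> (inverse r * a) \<le> ennreal (1 / real m)"
        using m(2) by (intro ennreal_mult_le_mult_iff) auto
      then show ?thesis
        by (simp only: one)
    qed
    also have "\<dots> \<longleftrightarrow> inverse r * a \<le> ?b"
      using m(2) r a by (intro orlicz_le_iff[OF \<phi>]) auto
    also have "\<dots> \<longleftrightarrow> a / ?b \<le> r"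
      using b r by (simp add: field_simps)
    finally show ?thesis .
  qed
  moreover have "a / ?b > 0"
    using a b by simp
  ultimately have "{r. r > 0 \<and> tr_orlicz \<phi> (diag_op e N c /\<^sub>R r) \<le> 1} = {a / ?b..}"
    by auto
  then show ?thesis
    unfolding luxemburg_norm_def by simp
qed

text \<open>The entries are taken of the form \<open>orlicz_inv \<phi> u\<close> because \<phi> may
  be infinite elsewhere. At such entries it equals the finite number \<open>u\<close>, so the
  scaling factor 1 already works.\<close>

lemma diag_op_in_orlicz_schatten:
  assumes "orthonormal N e" "orlicz_function \<phi>" "u > 0"
    and "\<And>i. i < N \<Longrightarrow> \<bar>c i\<bar> = 0 \<or> \<bar>c i\<bar> = orlicz_inv \<phi> u"
  shows "diag_op e N c \<in> orlicz_schatten \<phi>"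
proof -
  have "tr_orlicz \<phi> (1 *\<^sub>R diag_op e N c)
      = of_nat (card {i. i < N \<and> c i \<noteq> 0}) * \<phi> (orlicz_inv \<phi> u)"
    using tr_orlicz_diag_op[OF assms(1,2) orlicz_inv_pos[OF assms(2,3)] assms(4) refl] by simp
  also have "\<dots> < \<infinity>"
    using orlicz_inv_apply[OF assms(2,3)] by (simp add: ennreal_mult_less_top of_nat_less_top)
  finally have "\<exists>r>0. tr_orlicz \<phi> (r *\<^sub>R diag_op e N c) < \<infinity>"
    using zero_less_one by blast
  then show ?thesis
    by (simp add: orlicz_schatten_def compact_diag_op[OF assms(1)])
qed

section \<open>Lower bounds for the nonsquare constant\<close>

text \<open>In both constructions the sum and the difference have the same norm, so the minimum is
  that common value.\<close>

lemma nonsquare_const_geI: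
  assumes "x \<in> X" "y \<in> X" "nrm x = 1" "nrm y = 1" "nrm (x + y) = d" "nrm (x - y) = d"
  shows "ereal d \<le> nonsquare_const X nrm"
  unfolding nonsquare_const_def using assms by (intro Sup_upper) force

lemma nonsquare_const_ge_disjoint:
  assumes "infinite_dimensional TYPE('h::complex_hilbert)" "orlicz_function \<phi>" "n > 0"
  shows "ereal (orlicz_inv \<phi> (1 / real n) / orlicz_inv \<phi> (1 / real (2 * n)))
           \<le> nonsquare_const (orlicz_schatten \<phi> :: ('h \<Rightarrow>\<^sub>L 'h) set) (luxemburg_norm \<phi>)"
proof -
  obtain e :: "nat \<Rightarrow> 'h" where e: "orthonormal (2 * n) e"
    using exists_orthonormal[OF assms(1)] by blast
  \<comment> \<open>This value gives norm 1 to an operator with \<open>n\<close> entries of modulus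
    \<open>a\<close>.\<close>
  define a where "a = orlicz_inv \<phi> (1 / real n)"
  have a: "a > 0"
    unfolding a_def using assms(3) by (intro orlicz_inv_pos[OF assms(2)]) simp
  define c d where "c = (\<lambda>i. if i < n then a else 0)" and "d = (\<lambda>i. if i < n then 0 else a)"
  have supp: "{i. i < 2 * n \<and> c i \<noteq> 0} = {..<n}" "{i. i < 2 * n \<and> d i \<noteq> 0} = {n..<2 * n}"
    "{i. i < 2 * n \<and> c i + d i \<noteq> 0} = {..<2 * n}" "{i. i < 2 * n \<and> c i - d i \<noteq> 0} = {..<2 * n}"
    using a by (auto simp: c_def d_def split: if_splits)
  have vals: "\<bar>c i\<bar> = 0 \<or> \<bar>c i\<bar> = a" "\<bar>d i\<bar> = 0 \<or> \<bar>d i\<bar> = a"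
    "\<bar>c i + d i\<bar> = 0 \<or> \<bar>c i + d i\<bar> = a" "\<bar>c i - d i\<bar> = 0 \<or> \<bar>c i - d i\<bar> = a" for i
    using a by (auto simp: c_def d_def)
  let ?T = "diag_op e (2 * n)"
  note lux = luxemburg_norm_diag_op[OF e assms(2) a]
  have "?T c \<in> orlicz_schatten \<phi>" "?T d \<in> orlicz_schatten \<phi>"
    using assms(3)
    by (simp_all add: diag_op_in_orlicz_schatten[OF e assms(2) _ vals(1)[unfolded a_def]]
        diag_op_in_orlicz_schatten[OF e assms(2) _ vals(2)[unfolded a_def]])
  moreover have "luxemburg_norm \<phi> (?T c) = 1" "luxemburg_norm \<phi> (?T d) = 1"
    using lux[of c n] lux[of d n] vals supp a assms(3) by (simp_all flip: a_def)
  moreover have "luxemburg_norm \<phi> (?T c + ?T d) = a / orlicz_inv \<phi> (1 / real (2 * n))"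
    unfolding diag_op_add[OF e] by (rule lux) (use vals supp assms(3) in auto)
  moreover have "luxemburg_norm \<phi> (?T c - ?T d) = a / orlicz_inv \<phi> (1 / real (2 * n))"
    unfolding diag_op_diff[OF e] by (rule lux) (use vals supp assms(3) in auto)
  ultimately show ?thesis
    unfolding a_def by (rule nonsquare_const_geI)
qed

lemma nonsquare_const_ge_signs:
  assumes "infinite_dimensional TYPE('h::complex_hilbert)" "orlicz_function \<phi>" "n > 0"
  shows "ereal (2 * orlicz_inv \<phi> (1 / real (2 * n)) / orlicz_inv \<phi> (1 / real n))
           \<le> nonsquare_const (orlicz_schatten \<phi> :: ('h \<Rightarrow>\<^sub>L 'h) set) (luxemburg_norm \<phi>)"
proof -
  obtain e :: "nat \<Rightarrow> 'h" where e: "orthonormal (2 * n) e"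
    using exists_orthonormal[OF assms(1)] by blast
  \<comment> \<open>Here the unit vectors have \<open>2 * n\<close> nonzero entries, while their sum
    and difference each have \<open>n\<close> entries of modulus \<open>2 * a\<close>; hence the
    normalisation at 1/(2n).\<close>
  define a where "a = orlicz_inv \<phi> (1 / real (2 * n))"
  have a: "a > 0"
    unfolding a_def using assms(3) by (intro orlicz_inv_pos[OF assms(2)]) simp
  define c d where "c = (\<lambda>i::nat. a)" and "d = (\<lambda>i. if i < n then a else - a)"
  have supp: "{i. i < 2 * n \<and> c i \<noteq> 0} = {..<2 * n}" "{i. i < 2 * n \<and> d i \<noteq> 0} = {..<2 * n}"
    "{i. i < 2 * n \<and> c i + d i \<noteq> 0} = {..<n}" "{i. i < 2 * n \<and> c i - d i \<noteq> 0} = {n..<2 * n}"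
    using a by (auto simp: c_def d_def split: if_splits)
  have vals: "\<bar>c i\<bar> = 0 \<or> \<bar>c i\<bar> = a" "\<bar>d i\<bar> = 0 \<or> \<bar>d i\<bar> = a"
    "\<bar>c i + d i\<bar> = 0 \<or> \<bar>c i + d i\<bar> = 2 * a" "\<bar>c i - d i\<bar> = 0 \<or> \<bar>c i - d i\<bar> = 2 * a" for i
    using a by (auto simp: c_def d_def)
  let ?T = "diag_op e (2 * n)"
  note lux = luxemburg_norm_diag_op[OF e assms(2)]
  have "?T c \<in> orlicz_schatten \<phi>" "?T d \<in> orlicz_schatten \<phi>"
    using assms(3)
    by (simp_all add: diag_op_in_orlicz_schatten[OF e assms(2) _ vals(1)[unfolded a_def]]
        diag_op_in_orlicz_schatten[OF e assms(2) _ vals(2)[unfolded a_def]])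
  moreover have "luxemburg_norm \<phi> (?T c) = 1" "luxemburg_norm \<phi> (?T d) = 1"
    using lux[OF a, of c "2 * n"] lux[OF a, of d "2 * n"] vals supp a assms(3)
    by (simp_all flip: a_def del: of_nat_mult)
  moreover have "luxemburg_norm \<phi> (?T c + ?T d) = 2 * a / orlicz_inv \<phi> (1 / real n)"
    unfolding diag_op_add[OF e] by (rule lux) (use a vals supp assms(3) in auto)
  moreover have "luxemburg_norm \<phi> (?T c - ?T d) = 2 * a / orlicz_inv \<phi> (1 / real n)"
    unfolding diag_op_diff[OF e] by (rule lux) (use a vals supp assms(3) in auto)
  ultimately show ?thesis
    unfolding a_def by (rule nonsquare_const_geI)
qed

section \<open>From sample points to the indices\<close>

lemma orlicz_inv_ratio_bounds:
  assumes \<phi>: "orlicz_function \<phi>" and u: "0 < u" "u < 1 / 4"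
  defines "R \<equiv> \<lambda>v. orlicz_inv \<phi> v / orlicz_inv \<phi> (2 * v)"
  obtains n where "n > 0" "R u \<le> (1 + 4 * u) * R (1 / real (2 * n))"
    "R (1 / real (2 * n)) \<le> (1 + 4 * u) * R u"
proof -
  let ?g = "orlicz_inv \<phi>"
  \<comment> \<open>The integer for which \<open>u\<close> lies between the consecutive sample
    points 1/(2(n+1)) and 1/(2n). The bound 1/4 on \<open>u\<close> keeps \<open>n\<close> above 1,
    which gives n \<ge> 1/(4u).\<close>
  define n where "n = nat \<lfloor>1 / (2 * u)\<rfloor>"
  have n_eq: "real n = of_int \<lfloor>1 / (2 * u)\<rfloor>"
    using u(1) by (simp add: n_def)
  have le: "real n \<le> 1 / (2 * u)" and ge: "1 / (2 * u) < real n + 1"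
    unfolding n_eq by linarith+
  have "1 / (2 * u) > 2"
    using u by (simp add: field_simps)
  then have n: "real n > 1"
    using ge by linarith
  have u_le: "u \<le> 1 / (2 * n)" and u_ge: "1 / (2 * (real n + 1)) \<le> u"
    using le ge u(1) n by (simp_all add: field_simps)
  \<comment> \<open>The ratio of the two sample points around \<open>u\<close>. Its inverse 1 + 1/n
    is at most 1 + 4u, which is the error factor of the statement.\<close>
  define t where "t = real n / (real n + 1)"
  have t: "0 < t" "t \<le> 1"
    using n by (simp_all add: t_def)
  have "real n \<ge> 1 / (4 * u)"
  proof -
    have "1 / (4 * u) = 1 / (2 * u) / 2"
      by simp
    then show ?thesis
      using ge n by linarith
  qed
  then have "1 / real n \<le> 4 * u"
    using u(1) n by (simp add: field_simps)
  moreover have "1 / t = 1 + 1 / real n"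
    using n by (simp add: t_def field_simps)
  ultimately have t_inv: "1 / t \<le> 1 + 4 * u"
    by simp
  \<comment> \<open>Both \<open>u\<close> and \<open>2 * u\<close> lie within the factor \<open>t\<close> of a sampled point.\<close>
  have step: "t * ?g v \<le> ?g w" "?g w \<le> ?g v" if "v > 0" "w \<le> v" "t * v \<le> w" for v w
  proof -
    have "t * v > 0"
      using t that(1) by simp
    then show "t * ?g v \<le> ?g w" "?g w \<le> ?g v"
      using orlicz_inv_scale_ge[OF \<phi> that(1) t] orlicz_inv_mono[OF \<phi> _ that(3)]
        orlicz_inv_mono[OF \<phi> _ that(2)] that(3) by linarith+
  qed
  have "2 * (1 / (2 * y)) = 1 / y" for y :: real
    by simp
  from this[of "real n + 1"] this[of "real n"]
  have "t * (1 / real (2 * n)) = 1 / (2 * (real n + 1))"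
    "t * (1 / real n) = 2 * (1 / (2 * (real n + 1)))" "1 / real n = 2 * (1 / (2 * real n))"
    using n by (simp_all add: t_def)
  then have tv: "t * (1 / real (2 * n)) \<le> u" "t * (1 / real n) \<le> 2 * u" "2 * u \<le> 1 / real n"
    using u_ge u_le by linarith+
  have g1: "t * ?g (1 / real (2 * n)) \<le> ?g u" "?g u \<le> ?g (1 / real (2 * n))"
    using step[of "1 / real (2 * n)" u] u_le tv n by simp_all
  have g2: "t * ?g (1 / real n) \<le> ?g (2 * u)" "?g (2 * u) \<le> ?g (1 / real n)"
    using step[of "1 / real n" "2 * u"] tv n by simp_all
  have pos: "?g (1 / real (2 * n)) > 0" "?g (1 / real n) > 0" "?g u > 0" "?g (2 * u) > 0"
    using n u(1) by (auto intro!: orlicz_inv_pos[OF \<phi>])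
  have R_n: "R (1 / real (2 * n)) = ?g (1 / real (2 * n)) / ?g (1 / real n)"
    by (simp add: R_def)
  have R_pos: "R (1 / real (2 * n)) > 0" "R u > 0"
    unfolding R_n unfolding R_def using pos by simp_all
  \<comment> \<open>The inverse function at \<open>u\<close> does not exceed its sampled value, and
    at \<open>2 * u\<close> it falls short of its sample by at most the factor \<open>t\<close>. So
    a single factor 1/t is lost; the reverse estimate exchanges these roles.\<close>
  have "R u \<le> ?g (1 / real (2 * n)) / (t * ?g (1 / real n))"
    unfolding R_def using g1(2) g2(1) pos t by (intro frac_le) auto
  also have "\<dots> = 1 / t * R (1 / real (2 * n))"
    unfolding R_n by simp
  also have "\<dots> \<le> (1 + 4 * u) * R (1 / real (2 * n))"
    using t_inv R_pos(1) by (intro mult_right_mono) auto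
  finally have A: "R u \<le> (1 + 4 * u) * R (1 / real (2 * n))" .
  have "R (1 / real (2 * n)) \<le> (?g u / t) / ?g (2 * u)"
    unfolding R_n using g1(1) g2(2) pos t by (intro frac_le) (auto simp: field_simps)
  also have "\<dots> = 1 / t * R u"
    by (simp add: R_def)
  also have "\<dots> \<le> (1 + 4 * u) * R u"
    using t_inv R_pos(2) by (intro mult_right_mono) auto
  finally show thesis
    using n by (intro that[OF _ A]) simp
qed

theorem theorem4p1:
  fixes \<phi> :: "real \<Rightarrow> ennreal"
  assumes "infinite_dimensional TYPE('h::complex_hilbert)"
    and "separable TYPE('h)"
    and "orlicz_function \<phi>"
    and "delta2_at_0 \<phi>"
  shows "nonsquare_const (orlicz_schatten \<phi> :: ('h \<Rightarrow>\<^sub>L 'h) set) (luxemburg_norm \<phi>)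
           \<ge> max (inverse (alpha_index \<phi>)) (2 * beta_index \<phi>)"
proof -
  define J where
    "J = nonsquare_const (orlicz_schatten \<phi> :: ('h \<Rightarrow>\<^sub>L 'h) set) (luxemburg_norm \<phi>)"
  define R where "R v = orlicz_inv \<phi> v / orlicz_inv \<phi> (2 * v)" for v
  have R_pos: "R v > 0" if "v > 0" for v
    using that by (simp add: R_def orlicz_inv_pos[OF assms(3)])
  \<comment> \<open>Doubling 1/(2n) gives 1/n, so both constructions are governed by the same value
    of \<open>R\<close>: one through its reciprocal, the other through its double.\<close>
  have J_R: "ereal (inverse (R (1 / real (2 * n)))) \<le> J" "ereal (2 * R (1 / real (2 * n))) \<le> J"
    if "n > 0" for n
    using nonsquare_const_ge_disjoint[OF assms(1,3) that]
      nonsquare_const_ge_signs[OF assms(1,3) that] by (simp_all add: J_def R_def)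
  show ?thesis
    unfolding J_def[symmetric]
  \<comment> \<open>For J = \<infinity> nothing is to be shown, and J = -\<infinity> contradicts the
    real lower bounds \<open>J_R\<close>.\<close>
  proof (cases J)
    case (real j)
    have j: "inverse (R (1 / real (2 * n))) \<le> j" "2 * R (1 / real (2 * n)) \<le> j"
      if "n > 0" for n
      using J_R[OF that] real by simp_all
    have j_pos: "j > 0"
      using j(2)[of 1] R_pos[of "1 / 2"] by simp
    \<comment> \<open>At the sample points \<open>R\<close> lies between 1/j and j/2. This extends
      to all small \<open>u\<close> at the cost of the factor 1 + 4u, which tends to 1 and so
      disappears in the limits below.\<close>
    have bounds: "R u \<le> (1 + 4 * u) * (j / 2)" "inverse ((1 + 4 * u) * j) \<le> R u"
      if u: "0 < u" "u < 1 / 4" for u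
    proof -
      obtain n where n: "n > 0" "R u \<le> (1 + 4 * u) * R (1 / real (2 * n))"
        "R (1 / real (2 * n)) \<le> (1 + 4 * u) * R u"
        using orlicz_inv_ratio_bounds[OF assms(3) u] unfolding R_def by blast
      have "(1 + 4 * u) * R (1 / real (2 * n)) \<le> (1 + 4 * u) * (j / 2)"
        using j(2)[OF n(1)] u by (intro mult_left_mono) auto
      then show "R u \<le> (1 + 4 * u) * (j / 2)"
        using n(2) by linarith
      have "inverse j \<le> R (1 / real (2 * n))"
        using j(1)[OF n(1)] R_pos[of "1 / real (2 * n)"] n(1) j_pos
        by (simp add: field_simps)
      then have "inverse j \<le> (1 + 4 * u) * R u"
        using n(3) by linarith
      then have "inverse j / (1 + 4 * u) \<le> R u"
        using u by (simp add: pos_divide_le_eq mult.commute)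
      then show "inverse ((1 + 4 * u) * j) \<le> R u"
        by (simp add: divide_inverse mult.commute)
    qed
    have ev: "eventually (\<lambda>u. 0 < u \<and> u < (1 / 4 :: real)) (at_right 0)"
      by (auto simp: eventually_at_right_field intro!: exI[of _ "1 / 4"])
    have "beta_index \<phi> \<le> Limsup (at_right 0) (\<lambda>u. ereal ((1 + 4 * u) * (j / 2)))"
      unfolding beta_index_def R_def[symmetric]
      by (rule Limsup_mono, rule eventually_mono[OF ev]) (metis bounds(1) ereal_less_eq(3))
    also have "\<dots> = ereal (j / 2)"
      by (rule lim_imp_Limsup) (auto intro!: tendsto_eq_intros simp: tendsto_ident_at)
    finally have "2 * beta_index \<phi> \<le> 2 * ereal (j / 2)"
      by (rule ereal_mult_left_mono) simp
    then have beta: "2 * beta_index \<phi> \<le> J"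
      by (simp add: real)
    have "ereal (inverse j) = Liminf (at_right 0) (\<lambda>u. ereal (inverse ((1 + 4 * u) * j)))"
      by (rule lim_imp_Liminf[symmetric])
        (use j_pos in \<open>auto intro!: tendsto_eq_intros simp: tendsto_ident_at\<close>)
    also have "\<dots> \<le> alpha_index \<phi>"
      unfolding alpha_index_def R_def[symmetric]
      by (rule Liminf_mono, rule eventually_mono[OF ev]) (metis bounds(2) ereal_less_eq(3))
    \<comment> \<open>Inversion is antitone on nonnegative extended reals. The positive lower bound
      1/j excludes \<alpha> = 0, where the inverse would be infinite.\<close>
    finally have "inverse (alpha_index \<phi>) \<le> inverse (ereal (inverse j))"
      using j_pos by (intro ereal_inverse_antimono) auto
    then have "inverse (alpha_index \<phi>) \<le> J"
      using j_pos by (simp add: real)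
    then show "max (inverse (alpha_index \<phi>)) (2 * beta_index \<phi>) \<le> J"
      using beta by simp
  next
    case MInf
    then show "max (inverse (alpha_index \<phi>)) (2 * beta_index \<phi>) \<le> J"
      using J_R(2)[of 1] by simp
  qed simp
qed

end
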